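(* Let $\Sigma,\Gamma$ be finite alphabets, each with at least two letters. For every infinite word $w\in\Sigma^{\mathbb{N}}$, $$\mathrm{ACE}_{\mathcal{I}}(w) \le (|\Sigma|+1) + |\Sigma|(|\Sigma|+1)\big(\lfloor \mathrm{ACE}(w)\rfloor + 1\big).$$
   Context: $\mathrm{Fact}_n(w)$ is the set of length-$n$ factors of $w$. For a nonempty word $v$ and integer $p\ge0$, $v^{p/|v|}$ is the prefix of length $p$ of $vvv\cdots$. For a nonempty finite word $u$, $\mathrm{E}(u) = \sup\{ r \in \mathbb{Q} : u = v^r \text{ for some nonempty } v\}$. For an infinite word $w$, $\mathrm{ACE}(w) = \limsup_{n\to\infty}\sup\{\mathrm{E}(u) : u\in\mathrm{Fact}_n(w)\}$. $\mathcal{I}$ is the set of injective morphisms $\Sigma^*\to\Gamma^*$ and $\mathrm{ACE}_{\mathcal{I}}(w) = \sup\{\mathrm{ACE}(h(w)) : h\in\mathcal{I}\}$. (If $\mathrm{ACE}(w)=\infty$ the right-hand side is $\infty$.) *)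

theory Defs
  imports "HOL-Analysis.Analysis" "HOL-Library.Liminf_Limsup"
begin

definition Fact :: "nat \<Rightarrow> (nat \<Rightarrow> 'a) \<Rightarrow> 'a list set" where
  "Fact n w = {map (\<lambda>j. w (i + j)) [0..<n] | i. True}"

text \<open>v^(p/|v|): prefix of length p of vvv...\<close>
definition frac_pow :: "'a list \<Rightarrow> nat \<Rightarrow> 'a list" where
  "frac_pow v p = map (\<lambda>j. v ! (j mod length v)) [0..<p]"

text \<open>E(u) = sup { r rational : u = v^r, v nonempty }.  u = v^r forces r = |u|/|v|.\<close>
definition Exp :: "'a list \<Rightarrow> ereal" where
  "Exp u = Sup {ereal r | r v. v \<noteq> [] \<and> r \<in> \<rat> \<and> r * real (length v) = real (length u)
                               \<and> u = frac_pow v (length u)}"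

definition ACE :: "(nat \<Rightarrow> 'a) \<Rightarrow> ereal" where
  "ACE w = limsup (\<lambda>n. SUP u \<in> Fact n w. Exp u)"

definition morph :: "('a \<Rightarrow> 'b list) \<Rightarrow> 'a list \<Rightarrow> 'b list" where
  "morph h u = concat (map h u)"

definition inj_morphisms :: "('a \<Rightarrow> 'b list) set" where
  "inj_morphisms = {h. inj (morph h)}"

text \<open>Image h(w) of an infinite word (well defined when every h a is nonempty,
  which holds for injective morphisms): letter k of h(w) is letter k of
  h(w 0 ... w k).\<close>
definition morph_inf :: "('a \<Rightarrow> 'b list) \<Rightarrow> (nat \<Rightarrow> 'a) \<Rightarrow> (nat \<Rightarrow> 'b)" where
  "morph_inf h w k = morph h (map w [0..<Suc k]) ! k"

definition ACE_I :: "'b itself \<Rightarrow> (nat \<Rightarrow> 'a) \<Rightarrow> ereal" where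
  "ACE_I _ w = (SUP h \<in> (inj_morphisms :: ('a \<Rightarrow> 'b list) set). ACE (morph_inf h w))"

end

theory Submission
  imports Defs "HOL-Library.List_Lexorder"
begin

text \<open>
  Let \<open>B = \<lfloor>ACE(w)\<rfloor> + 1\<close>, let \<open>k\<close> be the number of letters of \<open>w\<close>, and consider a long factor of
  \<open>h(w)\<close> with least period \<open>p\<close>. Call the ends of the images of letters cuts. The stretch of \<open>w\<close>
  between two cuts congruent modulo \<open>p\<close> has as image a power of a conjugate of the repeated
  block, so for a fixed residue all these stretches commute by injectivity of \<open>h\<close>. Hence the
  stretch spanned by \<open>m + 1\<close> congruent cuts has each distance between two of them as a period. The
  least one gives exponent at least \<open>m\<close>, so \<open>m < B\<close> if the stretch is long. If \<open>p\<close> is bounded,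
  the pigeonhole principle on residues bounds the length of the factor of \<open>h(w)\<close>. If \<open>p\<close> exceeds
  all \<open>|h(a)|\<close>, let \<open>y\<close> be the start of a lexicographically least conjugate of the repeated
  block. That conjugate is unbordered, so for each letter \<open>a\<close> all occurrences of \<open>h(a)\<close> across the
  points \<open>y + jp\<close> cover them at the same offset. By the pigeonhole principle on letters, \<open>kB + 1\<close>
  such points produce \<open>B + 1\<close> congruent cuts, a contradiction. Hence long factors of \<open>h(w)\<close> have
  exponent less than \<open>kB + 3\<close>.
\<close>

section \<open>Finite sets\<close>

lemma Min_add_card_mult_gap_le_Max:
  fixes C :: "nat set"
  assumes "finite C" "C \<noteq> {}" and "\<And>a b. a \<in> C \<Longrightarrow> b \<in> C \<Longrightarrow> a < b \<Longrightarrow> a + g \<le> b"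
  shows "Min C + (card C - 1) * g \<le> Max C"
  using assms
proof (induction C rule: finite_linorder_max_induct)
  case (insert b A)
  show ?case
  proof (cases "A = {}")
    case False
    have "Max A + g \<le> b" using insert False by simp
    moreover have "Min A + (card A - 1) * g \<le> Max A" using insert False by simp
    moreover have "card A = Suc (card A - 1)"
      using insert.hyps False by (simp add: card_gt_0_iff)
    then have "card A * g = (card A - 1) * g + g" by (metis add.commute mult_Suc)
    moreover have "b \<notin> A" using insert.hyps by blast
    then have "Max (insert b A) = b" "Min (insert b A) = Min A" "card (insert b A) = Suc (card A)"
      using insert.hyps False by (simp_all add: max_absorb1 min_absorb2 less_imp_le)
    ultimately show ?thesis by simp
  qed simp
qed simp

lemma Min_add_card_le_Max:
  fixes C :: "nat set"
  assumes "finite C" "C \<noteq> {}"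
  shows "Min C + (card C - 1) \<le> Max C"
  using Min_add_card_mult_gap_le_Max[of C 1] assms by simp

lemma exists_close_pair:
  fixes C :: "nat set"
  assumes "finite C" "2 \<le> card C"
  shows "\<exists>a\<in>C. \<exists>b\<in>C. a < b \<and> (card C - 1) * (b - a) \<le> Max C - Min C"
proof (rule ccontr)
  let ?g = "Suc ((Max C - Min C) div (card C - 1))"
  assume no_pair: "\<not> ?thesis"
  have "a + ?g \<le> b" if "a \<in> C" "b \<in> C" "a < b" for a b
  proof -
    have "Max C - Min C < (b - a) * (card C - 1)"
      using no_pair that by (auto simp: not_le mult.commute)
    then have "(Max C - Min C) div (card C - 1) < b - a" by (rule less_mult_imp_div_less)
    then show ?thesis by simp
  qed
  then have "Min C + (card C - 1) * ?g \<le> Max C"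
    using assms by (intro Min_add_card_mult_gap_le_Max) auto
  moreover have "Max C - Min C < (card C - 1) * ?g"
    using assms(2) dividend_less_times_div[of "card C - 1" "Max C - Min C"] by simp
  ultimately show False by linarith
qed

lemma exists_large_fibre:
  assumes "f \<in> A \<rightarrow> B" "finite B" "card B * M < card A"
  shows "\<exists>y\<in>B. M < card (f -` {y} \<inter> A)"
proof -
  have "finite A" "A \<noteq> {}" using assms(3) by (auto intro: card_ge_0_finite)
  then obtain y where "y \<in> B" "card A \<le> card (f -` {y} \<inter> A) * card B"
    using pigeonhole_card[of f A B] assms(1,2) by blast
  moreover from this have "M * card B < card (f -` {y} \<inter> A) * card B"
    using assms(3) by (metis less_le_trans mult.commute)
  ultimately show ?thesis by auto
qed

section \<open>Unbordered conjugates of primitive words\<close>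

text \<open>A nonempty word is primitive in this sense iff it is not a proper power.\<close>

definition primitive_word :: "'a list \<Rightarrow> bool" where
  "primitive_word v \<longleftrightarrow> (\<forall>q. 0 < q \<and> q < length v \<longrightarrow> rotate q v \<noteq> v)"

definition unbordered :: "'a list \<Rightarrow> bool" where
  "unbordered v \<longleftrightarrow> (\<forall>q. 0 < q \<and> q < length v \<longrightarrow> take q v \<noteq> drop (length v - q) v)"

lemma primitive_word_rotate:
  assumes "primitive_word v"
  shows "primitive_word (rotate i v)"
proof -
  have "inj (rotate i :: 'a list \<Rightarrow> 'a list)"
    unfolding rotate_def using inj_rotate1 by (rule inj_fn)
  then have "rotate q (rotate i v) = rotate i v \<longleftrightarrow> rotate q v = v" for q
    by (metis add.commute injD rotate_rotate)
  then show ?thesis using assms by (simp add: primitive_word_def)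
qed

lemma list_le_append_same_leftD:
  fixes s :: "'a::linorder list"
  assumes "s @ x \<le> s @ y"
  shows "x \<le> y"
  using assms by (induction s) auto

lemma list_le_append_rightD:
  fixes x :: "'a::linorder list"
  assumes "x @ s \<le> y @ t" "length x = length y"
  shows "x \<le> y"
  using assms(2,1) by (induction x y rule: list_induct2) auto

lemma unbordered_least_rotation:
  fixes e :: "'a \<Rightarrow> 'b::linorder"
  assumes inj: "inj_on e (set v)" and "primitive_word v"
    and least: "\<And>q. map e v \<le> map e (rotate q v)"
  shows "unbordered v"
  unfolding unbordered_def
proof (intro allI impI notI)
  fix q assume q: "0 < q \<and> q < length v" and border: "take q v = drop (length v - q) v"
  define s x y where "s = take q v" and "x = drop q v" and "y = take (length v - q) v"
  have v: "v = s @ x" "v = y @ s"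
    by (simp add: s_def x_def) (simp add: s_def border y_def)
  have lengths: "length s = q" "length y = length v - q" "length y = length x"
    using q by (simp_all add: s_def x_def y_def)
  have rotations: "rotate q v = x @ s" "rotate (length v - q) v = s @ y"
    using rotate_append[of s x] rotate_append[of y s] v lengths by metis+
  have "map e (y @ s) \<le> map e (x @ s)" using least[of q] by (simp only: rotations flip: v(2))
  then have "map e y \<le> map e x" using lengths(3) by (auto intro: list_le_append_rightD)
  moreover have "map e (s @ x) \<le> map e (s @ y)"
    using least[of "length v - q"] by (simp only: rotations flip: v(1))
  then have "map e x \<le> map e y" by (auto intro: list_le_append_same_leftD)
  moreover have "set x \<union> set y \<subseteq> set v"
    by (auto simp: x_def y_def dest: in_set_dropD in_set_takeD)
  ultimately have "x = y"
    using inj by (metis antisym inj_on_map_eq_map inj_on_subset sup_commute)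
  then have "rotate q v = v" using rotations(1) v(2) by simp
  then show False using \<open>primitive_word v\<close> q by (simp add: primitive_word_def)
qed

lemma exists_unbordered_rotation:
  assumes "v \<noteq> []" "primitive_word v"
  shows "\<exists>i<length v. unbordered (rotate i v)"
proof -
  obtain e :: "'a \<Rightarrow> nat" where e: "inj_on e (set v)"
    using finite_imp_inj_to_nat_seg[OF finite_set[of v]] by blast
  let ?code = "\<lambda>i. map e (rotate i v)"
  obtain i where i: "i < length v" "?code i = Min (?code ` {..<length v})"
    using Min_in[of "?code ` {..<length v}"] assms(1) by fastforce
  have "?code i \<le> map e (rotate q (rotate i v))" for q
  proof -
    have "rotate q (rotate i v) = rotate ((q + i) mod length v) v"
      by (simp add: rotate_rotate flip: rotate_conv_mod)
    moreover have "(q + i) mod length v < length v" using assms(1) by simp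
    ultimately show ?thesis unfolding i(2) by (intro Min_le) auto
  qed
  then have "unbordered (rotate i v)"
    using e assms(2) by (intro unbordered_least_rotation[of e] primitive_word_rotate) simp_all
  then show ?thesis using i(1) by blast
qed

section \<open>Periods of factors\<close>

definition periodic_on :: "(nat \<Rightarrow> 'a) \<Rightarrow> nat \<Rightarrow> nat \<Rightarrow> nat \<Rightarrow> bool" where
  "periodic_on f s t p \<longleftrightarrow> 0 < p \<and> (\<forall>x. s \<le> x \<and> x + p < t \<longrightarrow> f (x + p) = f x)"

lemma periodic_on_pos: "periodic_on f s t p \<Longrightarrow> 0 < p"
  by (simp add: periodic_on_def)

lemma periodic_on_exceeding_length: "t - s < p \<Longrightarrow> periodic_on f s t p"
  by (auto simp: periodic_on_def)

lemma periodic_on_add_mult: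
  assumes "periodic_on f s t p" "s \<le> x" "x + k * p < t"
  shows "f (x + k * p) = f x"
  using assms(3)
proof (induction k)
  case (Suc k)
  then have "x + k * p + p < t" by simp
  then have "f (x + k * p + p) = f (x + k * p)"
    using assms(1,2) unfolding periodic_on_def by (meson trans_le_add1)
  also have "\<dots> = f x" using Suc by simp
  finally show ?case by (simp add: add_ac)
qed simp

lemma periodic_on_shifted_factor:
  assumes per: "periodic_on f s t p" and "s \<le> a" "b + k * p \<le> t"
  shows "map f [a + k * p..<b + k * p] = map f [a..<b]"
proof (rule nth_equalityI)
  fix x assume "x < length (map f [a + k * p..<b + k * p])"
  then show "map f [a + k * p..<b + k * p] ! x = map f [a..<b] ! x"
    using periodic_on_add_mult[OF per, of "a + x" k] assms by (simp add: add_ac)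
qed simp

lemma map_upt_eq_frac_pow_iff:
  "map f [s..<t] = frac_pow v (t - s) \<longleftrightarrow> (\<forall>k<t - s. f (s + k) = v ! (k mod length v))"
  by (simp add: list_eq_iff_nth_eq frac_pow_def)

lemma periodic_on_imp_frac_pow:
  assumes per: "periodic_on f s t p"
    and "s \<le> c" "c \<le> a" "b \<le> t" and cong: "c mod p = a mod p"
  shows "map f [a..<b] = frac_pow (map f [c..<c + p]) (b - a)"
  unfolding map_upt_eq_frac_pow_iff
proof (intro allI impI)
  fix k assume k: "k < b - a"
  have "(a + k) mod p = (c + k mod p) mod p"
    using cong by (metis mod_add_left_eq mod_add_right_eq)
  moreover have "c + k mod p \<le> a + k" using \<open>c \<le> a\<close> by (intro add_mono) simp_all
  ultimately obtain m where m: "a + k = c + k mod p + p * m" by (rule mod_eq_nat1E)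
  then have "f (a + k) = f (c + k mod p)"
    using periodic_on_add_mult[OF per, of "c + k mod p" m] k \<open>s \<le> c\<close> \<open>b \<le> t\<close>
    by (simp add: mult.commute)
  then show "f (a + k) = map f [c..<c + p] ! (k mod length (map f [c..<c + p]))"
    using periodic_on_pos[OF per] by simp
qed

lemma periodic_on_factor_eq_rotate:
  assumes per: "periodic_on f s t p" and "s + i + p \<le> t"
  shows "map f [s + i..<s + i + p] = rotate i (map f [s..<s + p])"
proof (rule nth_equalityI)
  fix k assume "k < length (map f [s + i..<s + i + p])"
  then have k: "k < p" by simp
  have "map f [s..<t] = frac_pow (map f [s..<s + p]) (t - s)"
    by (rule periodic_on_imp_frac_pow[OF per]) simp_all
  then have "f (s + (i + k)) = map f [s..<s + p] ! ((i + k) mod p)"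
    using k assms(2) by (simp add: map_upt_eq_frac_pow_iff)
  then show "map f [s + i..<s + i + p] ! k = rotate i (map f [s..<s + p]) ! k"
    using k by (simp add: nth_rotate add.assoc)
qed simp

lemma frac_pow_imp_periodic_on:
  assumes "map f [s..<t] = frac_pow v (t - s)" "v \<noteq> []"
  shows "periodic_on f s t (length v)"
  unfolding periodic_on_def
proof (intro conjI allI impI)
  fix x assume x: "s \<le> x \<and> x + length v < t"
  then obtain k where k: "x = s + k" by (auto simp: le_iff_add)
  have "f (s + (k + length v)) = f (s + k)"
    using assms(1) x k unfolding map_upt_eq_frac_pow_iff by simp
  then show "f (x + length v) = f x" using k by (simp add: add.assoc)
qed (use assms(2) in simp)

lemma frac_pow_append:
  assumes "length v dvd m"
  shows "frac_pow v m @ frac_pow v n = frac_pow v (m + n)"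
proof (rule nth_equalityI)
  fix x assume "x < length (frac_pow v m @ frac_pow v n)"
  moreover have "(x - m) mod length v = x mod length v" if "m \<le> x"
    using assms that by (auto simp: dvd_def le_iff_add)
  ultimately show "(frac_pow v m @ frac_pow v n) ! x = frac_pow v (m + n) ! x"
    by (auto simp: frac_pow_def nth_append)
qed (simp add: frac_pow_def)

lemma periodic_on_if_commute:
  assumes commute: "map f [a..<b] @ map f [s..<t] = map f [s..<t] @ map f [a..<b]" and "a < b"
  shows "periodic_on f s t (b - a)"
  unfolding periodic_on_def
proof (intro conjI allI impI)
  fix x assume x: "s \<le> x \<and> x + (b - a) < t"
  then obtain k where k: "x = s + k" "k + (b - a) < t - s" by (auto simp: le_iff_add)
  have "(map f [a..<b] @ map f [s..<t]) ! (k + (b - a)) = f x"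
    using x k by (simp add: nth_append)
  moreover have "(map f [s..<t] @ map f [a..<b]) ! (k + (b - a)) = f (x + (b - a))"
    using x k by (simp add: nth_append add.assoc)
  ultimately show "f (x + (b - a)) = f x" using commute by simp
qed (use \<open>a < b\<close> in simp)

definition least_period :: "(nat \<Rightarrow> 'a) \<Rightarrow> nat \<Rightarrow> nat \<Rightarrow> nat" where
  "least_period f s t = (LEAST p. periodic_on f s t p)"

lemma periodic_on_least_period: "periodic_on f s t (least_period f s t)"
  unfolding least_period_def
  by (rule LeastI[of _ "Suc (t - s)"]) (simp add: periodic_on_exceeding_length)

lemma least_period_le: "periodic_on f s t p \<Longrightarrow> least_period f s t \<le> p"
  unfolding least_period_def by (rule Least_le)

lemma primitive_word_least_period:
  "primitive_word (map f [s..<s + least_period f s t])"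
  unfolding primitive_word_def
proof (intro allI impI notI)
  define p where "p = least_period f s t"
  define v where "v = map f [s..<s + p]"
  fix q assume "0 < q \<and> q < length (map f [s..<s + least_period f s t])"
    and "rotate q (map f [s..<s + least_period f s t]) = map f [s..<s + least_period f s t]"
  then have q: "0 < q" "q < p" and rotate: "rotate q v = v" by (simp_all add: v_def p_def)
  have "map f [s..<t] = frac_pow v (t - s)"
    unfolding v_def p_def
    by (intro periodic_on_imp_frac_pow[OF periodic_on_least_period]) simp_all
  then have nth: "f (s + k) = v ! (k mod p)" if "k < t - s" for k
    using that by (simp add: map_upt_eq_frac_pow_iff v_def)
  have "periodic_on f s t q"
    unfolding periodic_on_def
  proof (intro conjI allI impI)
    fix x assume x: "s \<le> x \<and> x + q < t"
    then obtain k where k: "x = s + k" by (auto simp: le_iff_add)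
    have "f (x + q) = v ! ((q + k mod p) mod p)"
      using x k nth[of "k + q"] by (simp add: mod_simps add_ac)
    also have "\<dots> = rotate q v ! (k mod p)" using q by (subst nth_rotate) (simp_all add: v_def)
    also have "\<dots> = f x" using x k nth[of k] rotate by simp
    finally show "f (x + q) = f x" .
  qed (fact q)
  then show False using least_period_le q(2) by (metis leD p_def)
qed

text \<open>A critical point of order \<open>p\<close> is one at which no square of period less than \<open>p\<close> is centred;
  if \<open>q > y\<close>, the words compared have different lengths.\<close>

definition critical_point :: "(nat \<Rightarrow> 'a) \<Rightarrow> nat \<Rightarrow> nat \<Rightarrow> bool" where
  "critical_point f p y \<longleftrightarrow> (\<forall>q. 0 < q \<and> q < p \<longrightarrow> map f [y - q..<y] \<noteq> map f [y..<y + q])"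

lemma critical_point_if_unbordered:
  assumes unbordered: "unbordered (map f [y..<y + p])"
    and square: "map f [y - p..<y] = map f [y..<y + p]" and "p \<le> y"
  shows "critical_point f p y"
  unfolding critical_point_def
proof (intro allI impI)
  fix q assume q: "0 < q \<and> q < p"
  have "map f [y..<y + q] = take q (map f [y..<y + p])"
    using q by (simp add: take_map)
  moreover have "map f [y - q..<y] = drop (p - q) (map f [y - p..<y])"
    using q \<open>p \<le> y\<close> by (simp add: drop_map)
  moreover have "take q (map f [y..<y + p]) \<noteq> drop (p - q) (map f [y..<y + p])"
    using unbordered q by (simp add: unbordered_def)
  ultimately show "map f [y - q..<y] \<noteq> map f [y..<y + q]" by (metis square)
qed

lemma exists_critical_point:
  fixes f :: "nat \<Rightarrow> 'a" and s t :: nat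
  defines "p \<equiv> least_period f s t"
  assumes "s + 3 * p \<le> t"
  shows "\<exists>y. s + p \<le> y \<and> y < s + 2 * p \<and> critical_point f p y"
proof -
  have per: "periodic_on f s t p" unfolding p_def by (rule periodic_on_least_period)
  have "primitive_word (map f [s..<s + p])" unfolding p_def by (rule primitive_word_least_period)
  then obtain i where i: "i < p" and unbordered: "unbordered (rotate i (map f [s..<s + p]))"
    using exists_unbordered_rotation[of "map f [s..<s + p]"] periodic_on_pos[OF per] by auto
  define y where "y = s + i + p"
  have conjugate: "map f [y - p..<y] = rotate i (map f [s..<s + p])"
    using periodic_on_factor_eq_rotate[OF per, of i] i assms(2) by (simp add: y_def)
  have square: "map f [y - p..<y] = map f [y..<y + p]"
    using periodic_on_shifted_factor[OF per, of "y - p" y 1] i assms(2) by (simp add: y_def)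
  have "unbordered (map f [y..<y + p])" unfolding square[symmetric] conjugate by fact
  then have "critical_point f p y"
    using square by (rule critical_point_if_unbordered) (simp add: y_def)
  then show ?thesis using i by (intro exI[of _ y]) (simp add: y_def)
qed

lemma critical_point_offset_le:
  assumes crit: "critical_point f p y"
    and occ: "map f [y - d..<y - d + l] = map f [y - d'..<y - d' + l]"
    and "d < l" "l \<le> p" "d \<le> y" "d' \<le> y"
  shows "d \<le> d'"
proof (rule ccontr)
  assume "\<not> d \<le> d'"
  define q where "q = d - d'"
  have q: "0 < q" "q < p" "q \<le> y" "d = d' + q"
    using \<open>\<not> d \<le> d'\<close> assms(3-6) by (simp_all add: q_def)
  have "map f [y - q..<y] = map f [y..<y + q]"
  proof (rule nth_equalityI)
    fix k assume "k < length (map f [y - q..<y])"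
    then have k: "k < q" using q by simp
    have "map f [y - q..<y] ! k = map f [y - d..<y - d + l] ! (d' + k)"
      using k q assms(3,5) by (simp add: add.commute)
    also have "\<dots> = map f [y - d'..<y - d' + l] ! (d' + k)" by (simp only: occ)
    also have "\<dots> = map f [y..<y + q] ! k" using k q assms(3,6) by simp
    finally show "map f [y - q..<y] ! k = map f [y..<y + q] ! k" .
  qed (use q in simp)
  then show False using crit q by (simp add: critical_point_def)
qed

section \<open>Exponents and periods\<close>

lemma Fact_eq_range: "Fact n w = range (\<lambda>s. map w [s..<s + n])"
proof -
  have "map (\<lambda>j. w (s + j)) [0..<n] = map w [s..<s + n]" for s
    by (rule nth_equalityI) simp_all
  then show ?thesis by (auto simp: Fact_def)
qed

lemma map_upt_in_Fact: "map w [s..<t] \<in> Fact (t - s) w"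
proof -
  have "map w [s..<t] = map w [s..<s + (t - s)]" by (cases "s \<le> t") simp_all
  then show ?thesis unfolding Fact_eq_range by (rule range_eqI)
qed

lemma periodic_on_imp_Exp_ge:
  assumes "periodic_on w s t p"
  shows "ereal (real (t - s) / real p) \<le> Exp (map w [s..<t])"
  unfolding Exp_def
proof (intro Sup_upper CollectI exI conjI)
  have "0 < p" using assms by (rule periodic_on_pos)
  then show "map w [s..<s + p] \<noteq> []"
    "real (t - s) / real p * real (length (map w [s..<s + p])) = real (length (map w [s..<t]))"
    by simp_all
  show "map w [s..<t] = frac_pow (map w [s..<s + p]) (length (map w [s..<t]))"
    unfolding length_map length_upt by (rule periodic_on_imp_frac_pow[OF assms]) simp_all
qed simp_all

lemma Exp_leI:
  assumes "\<And>p. periodic_on w s t p \<Longrightarrow> real (t - s) \<le> r * real p"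
  shows "Exp (map w [s..<t]) \<le> ereal r"
  unfolding Exp_def
proof (rule Sup_least, clarify)
  fix q v
  assume "v \<noteq> []" and q: "q * real (length v) = real (length (map w [s..<t]))"
    and "map w [s..<t] = frac_pow v (length (map w [s..<t]))"
  then have "periodic_on w s t (length v)" by (intro frac_pow_imp_periodic_on) simp_all
  then have "q * real (length v) \<le> r * real (length v)" using assms q by simp
  then show "ereal q \<le> ereal r" using \<open>v \<noteq> []\<close> by simp
qed

lemma ACE_nonneg: "0 \<le> ACE w"
  unfolding ACE_def
proof (rule le_Limsup)
  have "0 \<le> (SUP u\<in>Fact n w. Exp u)" for n
  proof (rule SUP_upper2)
    show "map w [0..<n] \<in> Fact n w" using map_upt_in_Fact[of w 0 n] by simp
    have "0 \<le> ereal (real (n - 0) / real (Suc n))" by simp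
    also have "\<dots> \<le> Exp (map w [0..<n])"
      by (intro periodic_on_imp_Exp_ge periodic_on_exceeding_length) simp
    finally show "0 \<le> Exp (map w [0..<n])" .
  qed
  then show "\<forall>\<^sub>F n in sequentially. 0 \<le> (SUP u\<in>Fact n w. Exp u)" by simp
qed simp

definition no_long_powers :: "nat \<Rightarrow> nat \<Rightarrow> (nat \<Rightarrow> 'a) \<Rightarrow> bool" where
  "no_long_powers N B w \<longleftrightarrow> (\<forall>s t p. s + N \<le> t \<and> periodic_on w s t p \<longrightarrow> t - s < B * p)"

lemma no_long_powersD:
  "no_long_powers N B w \<Longrightarrow> s + N \<le> t \<Longrightarrow> periodic_on w s t p \<Longrightarrow> t - s < B * p"
  by (simp add: no_long_powers_def)

lemma no_long_powers_pos:
  assumes "no_long_powers N B w"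
  shows "0 < B"
proof -
  have "periodic_on w 0 N (Suc N)" by (simp add: periodic_on_exceeding_length)
  then have "N - 0 < B * Suc N" by (rule no_long_powersD[OF assms, rotated]) simp
  then show ?thesis by (cases B) simp_all
qed

lemma ACE_less_imp_no_long_powers:
  assumes "ACE w < ereal (real B)"
  shows "\<exists>N. no_long_powers N B w"
proof -
  obtain N where N: "\<And>n. N \<le> n \<Longrightarrow> (SUP u\<in>Fact n w. Exp u) < ereal (real B)"
    using Limsup_lessD[OF assms[unfolded ACE_def]] by (auto simp: eventually_sequentially)
  have "t - s < B * p" if "s + N \<le> t" and per: "periodic_on w s t p" for s t p
  proof -
    have "ereal (real (t - s) / real p) \<le> Exp (map w [s..<t])"
      using per by (rule periodic_on_imp_Exp_ge)
    also have "\<dots> \<le> (SUP u\<in>Fact (t - s) w. Exp u)"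
      using map_upt_in_Fact by (rule SUP_upper)
    also have "\<dots> < ereal (real B)" using that(1) by (intro N) simp
    finally have "real (t - s) < real B * real p"
      using periodic_on_pos[OF per] by (simp add: field_simps)
    then show ?thesis by (simp only: of_nat_less_iff flip: of_nat_mult)
  qed
  then show ?thesis unfolding no_long_powers_def by blast
qed

lemma no_long_powers_imp_ACE_le:
  assumes "no_long_powers N B w"
  shows "ACE w \<le> ereal (real B)"
proof -
  have "Exp u \<le> ereal (real B)" if n: "N \<le> n" and u: "u \<in> Fact n w" for n u
  proof -
    obtain s where s: "u = map w [s..<s + n]" using u by (auto simp: Fact_eq_range)
    have "n < B * p" if "periodic_on w s (s + n) p" for p
      using no_long_powersD[OF assms _ that] n by simp
    then show ?thesis unfolding s
      by (intro Exp_leI) (simp add: less_imp_le flip: of_nat_mult)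
  qed
  then have "\<forall>\<^sub>F n in sequentially. (SUP u\<in>Fact n w. Exp u) \<le> ereal (real B)"
    by (intro eventually_sequentiallyI[of N] SUP_least)
  then show ?thesis unfolding ACE_def by (rule Limsup_bounded)
qed

section \<open>Cuts in the image of a word\<close>

lemma morph_append: "morph h (u @ v) = morph h u @ morph h v"
  by (simp add: morph_def)

lemma map_upt_append:
  assumes "i \<le> j" "j \<le> k"
  shows "map w [i..<j] @ map w [j..<k] = map w [i..<k]"
  using assms by (metis le_add_diff_inverse map_append upt_add_eq_append)

locale nonerasing_image =
  fixes h :: "'a \<Rightarrow> 'b list" and w :: "nat \<Rightarrow> 'a"
  assumes nonerasing: "h a \<noteq> []"
begin

abbreviation image_word :: "nat \<Rightarrow> 'b" where
  "image_word \<equiv> morph_inf h w"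

definition cut :: "nat \<Rightarrow> nat" where
  "cut i = length (morph h (map w [0..<i]))"

lemma cut_0 [simp]: "cut 0 = 0"
  by (simp add: cut_def morph_def)

lemma cut_Suc: "cut (Suc i) = cut i + length (h (w i))"
  by (simp add: cut_def morph_def)

lemma strict_mono_cut: "strict_mono cut"
  by (rule strict_monoI_Suc) (simp add: cut_Suc nonerasing)

lemma cut_le_iff [simp]: "cut i \<le> cut j \<longleftrightarrow> i \<le> j"
  by (rule strict_mono_less_eq) (rule strict_mono_cut)

lemma le_cut: "i \<le> cut i"
  using strict_mono_cut by (rule strict_mono_imp_increasing)

lemma cut_add_le:
  assumes "\<And>i. length (h (w i)) \<le> P"
  shows "cut (i + k) \<le> cut i + k * P"
proof (induction k)
  case (Suc k)
  then show ?case using assms[of "i + k"] by (simp add: cut_Suc)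
qed simp

lemma image_word_nth:
  assumes "x < cut i"
  shows "image_word x = morph h (map w [0..<i]) ! x"
proof -
  have prefix: "morph h (map w [0..<k]) ! x = morph h (map w [0..<j]) ! x"
    if "j \<le> k" "x < cut j" for j k
    using that by (simp add: morph_append nth_append cut_def flip: map_upt_append[of 0 j k])
  have "x < cut (Suc x)" using le_cut[of "Suc x"] by simp
  then show ?thesis unfolding morph_inf_def
    using prefix[of i "Suc x"] prefix[of "Suc x" i] assms by (cases "i \<le> Suc x") auto
qed

lemma morph_factor:
  assumes "i \<le> j"
  shows "morph h (map w [i..<j]) = map image_word [cut i..<cut j]"
proof -
  have prefix: "morph h (map w [0..<k]) = map image_word [0..<cut k]" for k
    by (rule nth_equalityI) (simp_all add: image_word_nth flip: cut_def)
  have "map image_word [0..<cut i] @ morph h (map w [i..<j]) =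
      morph h (map w [0..<i] @ map w [i..<j])"
    by (simp only: prefix morph_append)
  also have "\<dots> = map image_word [0..<cut i] @ map image_word [cut i..<cut j]"
    using assms by (simp only: prefix map_upt_append cut_le_iff le0)
  finally show ?thesis by simp
qed

definition cover :: "nat \<Rightarrow> nat" where
  "cover x = (LEAST i. x < cut (Suc i))"

lemma less_cut_Suc_cover: "x < cut (Suc (cover x))"
  unfolding cover_def using le_cut[of "Suc x"] by (intro LeastI[of "\<lambda>i. x < cut (Suc i)" x]) simp

lemma cut_cover_le: "cut (cover x) \<le> x"
proof (cases "cover x")
  case (Suc i)
  then have "\<not> x < cut (Suc i)" unfolding cover_def by (intro not_less_Least) simp
  then show ?thesis using Suc by simp
qed simp

definition offset :: "nat \<Rightarrow> nat" where
  "offset x = x - cut (cover x)"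

lemma cut_cover_add_offset: "cut (cover x) + offset x = x"
  by (simp add: offset_def cut_cover_le)

lemma offset_less: "offset x < length (h (w (cover x)))"
  using less_cut_Suc_cover[of x] cut_cover_le[of x] by (simp add: offset_def cut_Suc)

lemma map_image_word_cover:
  "map image_word [x - offset x..<x - offset x + length (h (w (cover x)))] = h (w (cover x))"
proof -
  have "morph h (map w [cover x..<Suc (cover x)]) = h (w (cover x))" by (simp add: morph_def)
  moreover have "x - offset x = cut (cover x)" using cut_cover_le[of x] by (simp add: offset_def)
  ultimately show ?thesis using morph_factor[of "cover x" "Suc (cover x)"] by (simp add: cut_Suc)
qed

definition congruent_cuts :: "nat \<Rightarrow> nat \<Rightarrow> nat \<Rightarrow> nat \<Rightarrow> nat set" where
  "congruent_cuts s t p r = {i. s \<le> cut i \<and> cut i \<le> t \<and> cut i mod p = r}"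

lemma finite_congruent_cuts: "finite (congruent_cuts s t p r)"
proof (rule finite_subset)
  show "congruent_cuts s t p r \<subseteq> {..t}"
    using le_cut by (auto simp: congruent_cuts_def intro: order_trans)
qed simp

lemma exists_many_congruent_cuts:
  assumes images_le: "\<And>i. length (h (w i)) \<le> P" and "0 < p" and long: "s + P + p * M * P \<le> t"
  shows "\<exists>r. M < card (congruent_cuts s t p r)"
proof -
  define A where "A = {Suc (cover s)..Suc (cover s) + p * M}"
  have in_range: "s \<le> cut c \<and> cut c \<le> t" if "c \<in> A" for c
  proof -
    define k where "k = c - Suc (cover s)"
    have k: "c = Suc (cover s) + k" "k \<le> p * M" using that by (auto simp: A_def k_def)
    have "s \<le> cut (Suc (cover s))" using less_cut_Suc_cover by (rule less_imp_le)
    also have "\<dots> \<le> cut c" by (simp add: k)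
    finally have "s \<le> cut c" .
    have "cut c \<le> cut (Suc (cover s)) + k * P" unfolding k(1) using images_le by (rule cut_add_le)
    also have "\<dots> \<le> (s + P) + p * M * P"
      using cut_cover_le[of s] images_le[of "cover s"] k(2)
      by (intro add_mono mult_le_mono1) (simp_all add: cut_Suc)
    finally show ?thesis using \<open>s \<le> cut c\<close> long by simp
  qed
  obtain r where r: "M < card ((\<lambda>c. cut c mod p) -` {r} \<inter> A)"
    using exists_large_fibre[of "\<lambda>c. cut c mod p" A "{..<p}" M] \<open>0 < p\<close> by (auto simp: A_def)
  have "(\<lambda>c. cut c mod p) -` {r} \<inter> A \<subseteq> congruent_cuts s t p r"
    using in_range by (auto simp: congruent_cuts_def)
  then have "card ((\<lambda>c. cut c mod p) -` {r} \<inter> A) \<le> card (congruent_cuts s t p r)"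
    using finite_congruent_cuts by (rule card_mono[rotated])
  with r show ?thesis by (blast intro: less_le_trans)
qed

lemma cut_diff_ge_period:
  assumes images_le: "\<And>i. length (h (w i)) \<le> P"
    and "i \<in> congruent_cuts s t p r" "j \<in> congruent_cuts s t p r" "i < j"
  shows "p \<le> (j - i) * P"
proof -
  have "cut i < cut j" using strict_mono_cut \<open>i < j\<close> by (simp add: strict_mono_less)
  moreover have "p dvd cut j - cut i"
    using assms calculation by (simp add: congruent_cuts_def flip: mod_eq_dvd_iff_nat)
  ultimately have "p \<le> cut j - cut i" by (intro dvd_imp_le) simp_all
  also have "\<dots> \<le> (j - i) * P" using cut_add_le[OF images_le, of i "j - i"] \<open>i < j\<close> by simp
  finally show ?thesis .
qed

lemma covering_letter_occurs_at_translate: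
  assumes images_le: "\<And>i. length (h (w i)) \<le> P" and per: "periodic_on image_word s t p"
    and "s + P \<le> y" "y + j * p + P \<le> t"
  defines "x \<equiv> y + j * p"
  shows "map image_word [y - offset x..<y - offset x + length (h (w (cover x)))] = h (w (cover x))"
proof -
  have "offset x \<le> P" using offset_less[of x] images_le[of "cover x"] by linarith
  then have "x - offset x = y - offset x + j * p" using assms(3) by (simp add: x_def)
  then have "h (w (cover x)) = map image_word
      [y - offset x + j * p..<y - offset x + length (h (w (cover x))) + j * p]"
    using map_image_word_cover[of x] by (simp add: add_ac)
  also have "\<dots> = map image_word [y - offset x..<y - offset x + length (h (w (cover x)))]"
    using assms(3,4) images_le[of "cover x"] \<open>offset x \<le> P\<close>
    by (intro periodic_on_shifted_factor[OF per]) simp_all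
  finally show ?thesis by simp
qed

lemma offset_translate_le:
  assumes images_le: "\<And>i. length (h (w i)) \<le> P" and per: "periodic_on image_word s t p"
    and crit: "critical_point image_word p y" and "P \<le> p" "s + P \<le> y"
    and j: "y + j * p + P \<le> t" and k: "y + k * p + P \<le> t"
    and same_letter: "w (cover (y + j * p)) = w (cover (y + k * p))"
  shows "offset (y + j * p) \<le> offset (y + k * p)"
proof (rule critical_point_offset_le[OF crit])
  define a where "a = w (cover (y + j * p))"
  show "map image_word [y - offset (y + j * p)..<y - offset (y + j * p) + length (h a)] =
      map image_word [y - offset (y + k * p)..<y - offset (y + k * p) + length (h a)]"
    using covering_letter_occurs_at_translate[OF images_le per \<open>s + P \<le> y\<close> j]
      covering_letter_occurs_at_translate[OF images_le per \<open>s + P \<le> y\<close> k]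
    by (simp only: a_def same_letter)
  have "length (h a) \<le> P" by (simp add: a_def images_le)
  moreover show "offset (y + j * p) < length (h a)" by (simp add: a_def offset_less)
  moreover have "offset (y + k * p) < length (h a)"
    by (simp add: a_def same_letter offset_less)
  ultimately show "length (h a) \<le> p" "offset (y + j * p) \<le> y" "offset (y + k * p) \<le> y"
    using \<open>P \<le> p\<close> \<open>s + P \<le> y\<close> by linarith+
qed

lemma card_le_card_congruent_cuts_if_same_offset:
  assumes "0 < p" "s + d \<le> y"
    and offset: "\<And>j. j \<in> J \<Longrightarrow> offset (y + j * p) = d" and inside: "\<And>j. j \<in> J \<Longrightarrow> y + j * p \<le> t"
  shows "card J \<le> card (congruent_cuts s t p ((y - d) mod p))"
proof (rule card_inj_on_le)
  have cut: "cut (cover (y + j * p)) = y - d + j * p" if "j \<in> J" for j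
    using cut_cover_add_offset[of "y + j * p"] offset[OF that] \<open>s + d \<le> y\<close> by linarith
  show "inj_on (\<lambda>j. cover (y + j * p)) J"
  proof (rule inj_onI)
    fix j k assume "j \<in> J" "k \<in> J" "cover (y + j * p) = cover (y + k * p)"
    then have "j * p = k * p" using cut by (metis add_left_cancel)
    then show "j = k" using \<open>0 < p\<close> by simp
  qed
  show "(\<lambda>j. cover (y + j * p)) ` J \<subseteq> congruent_cuts s t p ((y - d) mod p)"
  proof clarify
    fix j assume "j \<in> J"
    have "cut (cover (y + j * p)) mod p = (y - d) mod p"
      unfolding cut[OF \<open>j \<in> J\<close>] by (rule mod_mult_self1)
    moreover have "s \<le> cut (cover (y + j * p))"
      using cut[OF \<open>j \<in> J\<close>] \<open>s + d \<le> y\<close> by linarith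
    moreover have "cut (cover (y + j * p)) \<le> t"
      using cut_cover_le inside[OF \<open>j \<in> J\<close>] by (rule order_trans)
    ultimately show "cover (y + j * p) \<in> congruent_cuts s t p ((y - d) mod p)"
      by (simp add: congruent_cuts_def)
  qed
qed (rule finite_congruent_cuts)

lemma exists_many_congruent_cuts_critical:
  assumes "finite (range w)" and images_le: "\<And>i. length (h (w i)) \<le> P"
    and per: "periodic_on image_word s t p" and crit: "critical_point image_word p y"
    and "P \<le> p" "s + P \<le> y" and long: "y + card (range w) * M * p + P \<le> t"
  shows "\<exists>r. M < card (congruent_cuts s t p r)"
proof -
  let ?letter = "\<lambda>j. w (cover (y + j * p))"
  obtain a where "M < card (?letter -` {a} \<inter> {..card (range w) * M})"
    using exists_large_fibre[of ?letter "{..card (range w) * M}" "range w" M] assms(1) by auto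
  define J where "J = ?letter -` {a} \<inter> {..card (range w) * M}"
  have "M < card J" unfolding J_def by fact
  then obtain i where "i \<in> J" by fastforce
  have inside: "y + j * p + P \<le> t" if "j \<in> J" for j
  proof -
    have "j * p \<le> card (range w) * M * p" using that by (intro mult_le_mono1) (simp add: J_def)
    then show ?thesis using long by linarith
  qed
  have "offset (y + j * p) \<le> offset (y + k * p)" if "j \<in> J" "k \<in> J" for j k
    using that inside \<open>P \<le> p\<close> \<open>s + P \<le> y\<close>
    by (intro offset_translate_le[OF images_le per crit]) (simp_all add: J_def)
  then have offset: "offset (y + j * p) = offset (y + i * p)" if "j \<in> J" for j
    using that \<open>i \<in> J\<close> by (intro antisym)
  have "offset (y + i * p) < P" using offset_less images_le by (rule less_le_trans)
  then have "card J \<le> card (congruent_cuts s t p ((y - offset (y + i * p)) mod p))"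
    using offset inside \<open>s + P \<le> y\<close> periodic_on_pos[OF per]
    by (intro card_le_card_congruent_cuts_if_same_offset) (auto intro: add_leD1)
  with \<open>M < card J\<close> show ?thesis by (blast intro: less_le_trans)
qed

end

locale injective_image =
  fixes h :: "'a \<Rightarrow> 'b list" and w :: "nat \<Rightarrow> 'a"
  assumes inj: "inj (morph h)"

sublocale injective_image \<subseteq> nonerasing_image h w
proof
  show "h a \<noteq> []" for a
  proof
    assume "h a = []"
    then have "morph h [a] = morph h []" by (simp add: morph_def)
    then show False using inj by (auto dest: injD)
  qed
qed

context injective_image
begin

lemma periodic_on_between_congruent_cuts:
  assumes per: "periodic_on image_word s t p"
    and C: "{a, b, c, c'} \<subseteq> congruent_cuts s t p r" and "c \<le> a" "a < b" "c \<le> c'"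
  shows "periodic_on w c c' (b - a)"
proof -
  define v where "v = map image_word [cut c..<cut c + p]"
  have image: "morph h (map w [i..<j]) = frac_pow v (cut j - cut i)"
    if "{i, j} \<subseteq> congruent_cuts s t p r" "c \<le> i" "i \<le> j" for i j
    unfolding morph_factor[OF \<open>i \<le> j\<close>] v_def
    using that C by (intro periodic_on_imp_frac_pow[OF per]) (auto simp: congruent_cuts_def)
  have dvd: "length v dvd cut j - cut i"
    if "{i, j} \<subseteq> congruent_cuts s t p r" "i \<le> j" for i j
    using that by (auto simp: congruent_cuts_def v_def simp flip: mod_eq_dvd_iff_nat)
  have "morph h (map w [a..<b] @ map w [c..<c']) = frac_pow v (cut b - cut a + (cut c' - cut c))"
    using image dvd assms by (simp add: morph_append frac_pow_append)
  also have "\<dots> = morph h (map w [c..<c'] @ map w [a..<b])"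
    using image dvd assms by (simp add: morph_append frac_pow_append add.commute)
  finally have "map w [a..<b] @ map w [c..<c'] = map w [c..<c'] @ map w [a..<b]"
    using inj by (auto dest: injD)
  then show ?thesis using \<open>a < b\<close> by (rule periodic_on_if_commute)
qed

lemma card_congruent_cuts_le:
  fixes s t p r :: nat
  assumes no_powers: "no_long_powers N B w" and per: "periodic_on image_word s t p"
  defines "C \<equiv> congruent_cuts s t p r"
  assumes "Min C + N \<le> Max C"
  shows "card C \<le> B"
proof (rule ccontr)
  assume "\<not> card C \<le> B"
  then have "2 \<le> card C" using no_long_powers_pos[OF no_powers] by simp
  have "finite C" by (simp add: C_def finite_congruent_cuts)
  then obtain a b where ab: "a \<in> C" "b \<in> C" "a < b" "(card C - 1) * (b - a) \<le> Max C - Min C"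
    using exists_close_pair \<open>2 \<le> card C\<close> by blast
  have "C \<noteq> {}" using ab(1) by blast
  have "{a, b, Min C, Max C} \<subseteq> congruent_cuts s t p r"
    using ab(1,2) Min_in[OF \<open>finite C\<close> \<open>C \<noteq> {}\<close>] Max_in[OF \<open>finite C\<close> \<open>C \<noteq> {}\<close>]
    by (simp flip: C_def)
  then have "periodic_on w (Min C) (Max C) (b - a)"
    using ab(1,3) \<open>finite C\<close> \<open>C \<noteq> {}\<close>
    by (intro periodic_on_between_congruent_cuts[OF per]) simp_all
  then have "Max C - Min C < B * (b - a)"
    by (rule no_long_powersD[OF no_powers assms(4)])
  then have "(card C - 1) * (b - a) < B * (b - a)" using ab(4) by linarith
  then have "card C - 1 < B" by simp
  then show False using \<open>\<not> card C \<le> B\<close> by linarith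
qed

lemma card_congruent_cuts_le_add:
  assumes no_powers: "no_long_powers N B w" and per: "periodic_on image_word s t p"
  shows "card (congruent_cuts s t p r) \<le> B + N"
proof (rule ccontr)
  define C where "C = congruent_cuts s t p r"
  assume "\<not> ?thesis"
  then have large: "B + N < card C" by (simp add: C_def)
  then have "finite C" "C \<noteq> {}" by (auto intro: card_ge_0_finite)
  then have "Min C + (card C - 1) \<le> Max C" by (rule Min_add_card_le_Max)
  then have "Min C + N \<le> Max C" using large no_long_powers_pos[OF no_powers] by linarith
  then have "card C \<le> B" unfolding C_def by (rule card_congruent_cuts_le[OF no_powers per])
  then show False using large by simp
qed

lemma card_congruent_cuts_le_if_long_period:
  assumes no_powers: "no_long_powers N B w" and per: "periodic_on image_word s t p"
    and images_le: "\<And>i. length (h (w i)) \<le> P" and long: "N * P < p"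
  shows "card (congruent_cuts s t p r) \<le> B"
proof (rule ccontr)
  define C where "C = congruent_cuts s t p r"
  assume "\<not> ?thesis"
  then have large: "B < card C" by (simp add: C_def)
  then have C: "finite C" "C \<noteq> {}" by (auto intro: card_ge_0_finite)
  then have "Min C + (card C - 1) \<le> Max C" by (rule Min_add_card_le_Max)
  then have "Min C < Max C" using large no_long_powers_pos[OF no_powers] by linarith
  then have "p \<le> (Max C - Min C) * P"
    using Min_in[OF C] Max_in[OF C] unfolding C_def by (intro cut_diff_ge_period[OF images_le])
  with long have "N * P < (Max C - Min C) * P" by (rule less_le_trans)
  then have "Min C + N \<le> Max C" by (simp add: less_diff_conv)
  then have "card C \<le> B" unfolding C_def by (rule card_congruent_cuts_le[OF no_powers per])
  then show False using large by simp
qed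

lemma length_less_if_short_period:
  assumes no_powers: "no_long_powers N B w" and images_le: "\<And>i. length (h (w i)) \<le> P"
    and per: "periodic_on image_word s t p" and "p \<le> Q"
  shows "t - s < P + Q * (B + N) * P"
proof (rule ccontr)
  assume "\<not> ?thesis"
  moreover have "p * (B + N) * P \<le> Q * (B + N) * P" using \<open>p \<le> Q\<close> by (intro mult_le_mono1)
  moreover have "0 < P" using images_le[of 0] nonerasing[of "w 0"] by (cases P) simp_all
  ultimately have "s + P + p * (B + N) * P \<le> t" by linarith
  then obtain r where "B + N < card (congruent_cuts s t p r)"
    using exists_many_congruent_cuts[OF images_le periodic_on_pos[OF per]] by blast
  moreover have "card (congruent_cuts s t p r) \<le> B + N"
    using no_powers per by (rule card_congruent_cuts_le_add)
  ultimately show False by simp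
qed

lemma length_less_if_long_least_period:
  fixes s t :: nat
  assumes "finite (range w)" and no_powers: "no_long_powers N B w"
    and images_le: "\<And>i. length (h (w i)) \<le> P"
  defines "p \<equiv> least_period image_word s t"
  assumes "P \<le> p" "N * P < p"
  shows "t - s < (card (range w) * B + 3) * p"
proof (rule ccontr)
  assume "\<not> ?thesis"
  then have "card (range w) * B * p + 3 * p \<le> t - s" by (simp add: algebra_simps)
  then have long: "s + card (range w) * B * p + 3 * p \<le> t" using \<open>N * P < p\<close> by linarith
  have per: "periodic_on image_word s t p" unfolding p_def by (rule periodic_on_least_period)
  obtain y where y: "s + p \<le> y" "y < s + 2 * p" "critical_point image_word p y"
    using exists_critical_point[of s image_word t] long unfolding p_def by auto
  then obtain r where "B < card (congruent_cuts s t p r)"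
    using exists_many_congruent_cuts_critical[OF assms(1) images_le per y(3), of B] long \<open>P \<le> p\<close>
    by auto
  moreover have "card (congruent_cuts s t p r) \<le> B"
    using no_powers per images_le \<open>N * P < p\<close> by (rule card_congruent_cuts_le_if_long_period)
  ultimately show False by simp
qed

lemma no_long_powers_image_word:
  assumes "finite (range w)" and no_powers: "no_long_powers N B w"
  shows "\<exists>M. no_long_powers M (card (range w) * B + 3) image_word"
proof -
  define P where "P = Max (range (\<lambda>i. length (h (w i))))"
  have "finite (range (\<lambda>i. length (h (w i))))"
    using finite_imageI[OF assms(1), of "\<lambda>a. length (h a)"] by (simp add: image_image)
  then have images_le: "length (h (w i)) \<le> P" for i by (simp add: P_def)
  define Q where "Q = Suc N * P"
  have "t - s < (card (range w) * B + 3) * p"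
    if "s + (P + Q * (B + N) * P) \<le> t" and per: "periodic_on image_word s t p" for s t p
  proof -
    have "Q < least_period image_word s t"
      using length_less_if_short_period[OF no_powers images_le periodic_on_least_period, of s t Q]
        that(1)
      by linarith
    then have "t - s < (card (range w) * B + 3) * least_period image_word s t"
      by (intro length_less_if_long_least_period[OF assms(1) no_powers images_le])
        (simp_all add: Q_def)
    also have "\<dots> \<le> (card (range w) * B + 3) * p"
      using least_period_le[OF per] by (rule mult_le_mono2)
    finally show ?thesis .
  qed
  then show ?thesis unfolding no_long_powers_def by blast
qed

end

lemma ACE_I_le:
  fixes w :: "nat \<Rightarrow> 'a"
  assumes "finite (range w)" "ACE w < ereal (real B)"
  shows "ACE_I TYPE('b) w \<le> ereal (real (card (range w) * B + 3))"
  unfolding ACE_I_def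
proof (rule SUP_least)
  fix h :: "'a \<Rightarrow> 'b list" assume "h \<in> inj_morphisms"
  then interpret injective_image h w by unfold_locales (simp add: inj_morphisms_def)
  show "ACE (morph_inf h w) \<le> ereal (real (card (range w) * B + 3))"
    using ACE_less_imp_no_long_powers[OF assms(2)] no_long_powers_image_word[OF assms(1)]
      no_long_powers_imp_ACE_le by blast
qed

theorem theorem22:
  fixes w :: "nat \<Rightarrow> 'a::finite"
  assumes "CARD('a) \<ge> 2" and "CARD('b::finite) \<ge> 2"
  shows "ACE_I TYPE('b) w \<le>
    (if ACE w = \<infinity> then \<infinity>
     else ereal (real (CARD('a) + 1)
       + real (CARD('a) * (CARD('a) + 1)) * (of_int \<lfloor>real_of_ereal (ACE w)\<rfloor> + 1)))"
proof (cases "ACE w = \<infinity>")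
  case False
  then obtain x where x: "ACE w = ereal x" "0 \<le> x"
    using ACE_nonneg[of w] by (cases "ACE w") auto
  define B where "B = nat (\<lfloor>x\<rfloor> + 1)"
  have real_B: "real B = of_int \<lfloor>x\<rfloor> + 1" using x(2) by (simp add: B_def)
  then have "1 \<le> B" using x(2) by linarith
  have "ACE w < ereal (real B)" using x real_B by (simp add: floor_less_iff)
  then have "ACE_I TYPE('b) w \<le> ereal (real (card (range w) * B + 3))"
    by (intro ACE_I_le) simp_all
  also have "\<dots> \<le> ereal (real (CARD('a) + 1 + CARD('a) * (CARD('a) + 1) * B))"
  proof -
    have "2 * 1 \<le> CARD('a) * (CARD('a) * B)"
      using assms(1) \<open>1 \<le> B\<close> by (intro mult_le_mono) simp_all
    moreover have "card (range w) * B \<le> CARD('a) * B" by (simp add: card_mono)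
    moreover have "CARD('a) * (CARD('a) + 1) * B = CARD('a) * B + CARD('a) * (CARD('a) * B)"
      by (simp add: algebra_simps)
    ultimately show ?thesis using assms(1) by (simp only: ereal_less_eq of_nat_le_iff)
  qed
  finally show ?thesis using x(1) by (simp add: real_B add_ac)
qed simp

end
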